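(* Let $n\ge1$ and let $b_1,\dots,b_{n-1}$ be complex numbers of modulus strictly less than $1$. For all $\lambda,\mu\in\mathbb{Y}_n$, $$\frac1{n!}\int_{\mathbb{T}^n}G_\lambda(z_1,\dots,z_n|\boldsymbol b)\,\overline G_\mu(z_1^{-1},\dots,z_n^{-1}|\boldsymbol b)\,\frac{\prod_{1\le i\ne j\le n}(1-z_i/z_j)}{\prod_{i=1}^n\prod_{j=1}^{n-1}(1-z_ib_j)}\prod_{i=1}^n\frac{dz_i}{2\pi\mathrm i z_i}=\mathbf 1_{\lambda=\mu}.$$
   Context: $\mathbb{T}=\{z\in\mathbb{C}:|z|=1\}$, positively oriented. For complex $|q|<1$, $(z;q)_k=\prod_{i=0}^{k-1}(1-zq^i)$ for $k\in\mathbb{Z}_{\ge0}$ (with $0^0=1$, so for $q=0$: $(z;0)_0=1$ and $(z;0)_k=1-z$ for $k\ge1$). $\mathbb{Y}_n$ is the set of integer partitions $\lambda=(\lambda_1\ge\dots\ge\lambda_n\ge0)$ with at most $n$ nonzero parts, with $\lambda_i=0$ for $i>n$; $|\lambda|=\sum_i\lambda_i$. For partitions, $\mu\preceq\lambda$ means $\lambda_i\ge\mu_i\ge\lambda_{i+1}$ for all $i\ge1$. Spin $q$-Whittaker polynomials: let $c_1,\dots,c_n,d_1,\dots,d_n$ be complex parameters of modulus $<1$. For $\lambda\in\mathbb{Y}_n$, $\mu\in\mathbb{Y}_{n-1}$ set $$\mathbb{F}_{\lambda/\mu}(x|c_1,\dots,c_n;d_1,\dots,d_n)=\mathbf 1_{\mu\preceq\lambda}\,x^{|\lambda|-|\mu|}\prod_{r=1}^n\frac{(c_r/x;q)_{\lambda_r-\mu_r}(xd_r;q)_{\mu_r-\lambda_{r+1}}(q;q)_{\lambda_r-\lambda_{r+1}}}{(q;q)_{\lambda_r-\mu_r}(q;q)_{\mu_r-\lambda_{r+1}}(c_rd_r;q)_{\lambda_r-\lambda_{r+1}}}.$$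 Define recursively, starting from $\mathbb{F}_\varnothing=1$ in zero variables, $$\mathbb{F}_\lambda(x_1,\dots,x_n|c_1,\dots,c_n;d_1,\dots,d_n)=\sum_{\mu\in\mathbb{Y}_{n-1},\,\mu\preceq\lambda}\mathbb{F}_\mu(x_1,\dots,x_{n-1}|c_2,\dots,c_n;d_1,\dots,d_{n-1})\,\mathbb{F}_{\lambda/\mu}(x_n|c_1,\dots,c_n;d_1,\dots,d_n).$$ These are polynomials, known to be symmetric in $x_1,\dots,x_n$. Set $$\mathsf f_\lambda(x_1,\dots,x_n|c_1,\dots,c_{n-1};d_1,\dots,d_{n-1})=\mathbb{F}_\lambda(x_1,\dots,x_n|c_1,\dots,c_{n-1},0;d_1,\dots,d_n),$$ which does not depend on $d_n$. The inhomogeneous symmetric Grothendieck polynomials and their variant are, with $\boldsymbol b=(b_1,\dots,b_{n-1})$ and $\boldsymbol 0=(0,\dots,0)$ of length $n-1$, $$G_\lambda(x_1,\dots,x_n|\boldsymbol b)=\mathsf f_\lambda(x_1,\dots,x_n|\boldsymbol 0;\boldsymbol b)\big|_{q=0},\qquad \overline G_\lambda(x_1,\dots,x_n|\boldsymbol b)=\mathsf f_\lambda(x_1,\dots,x_n|\boldsymbol b;\boldsymbol 0)\big|_{q=0}.$$ *)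

theory Defs
  imports "HOL-Complex_Analysis.Complex_Analysis"
begin

definition qpoch :: "complex \<Rightarrow> complex \<Rightarrow> nat \<Rightarrow> complex" where
  "qpoch z q k = (\<Prod>i<k. 1 - z * q ^ i)"

text \<open>
  All indices are shifted by one: a partition \<open>\<lambda>\<^sub>1 \<ge> \<lambda>\<^sub>2 \<ge> \<dots>\<close> is the function
  with \<open>i \<mapsto> \<lambda>\<^sub>i\<^sub>+\<^sub>1\<close>, and likewise for the variables and parameters, of which
  only the entries with index less than the respective length are meaningful.
\<close>

definition partitions :: "nat \<Rightarrow> (nat \<Rightarrow> nat) set" where
  "partitions n = {lam. antimono lam \<and> (\<forall>i\<ge>n. lam i = 0)}"

definition interlaces :: "(nat \<Rightarrow> nat) \<Rightarrow> (nat \<Rightarrow> nat) \<Rightarrow> bool" (infix "\<preceq>" 50) where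
  "mu \<preceq> lam \<longleftrightarrow> (\<forall>i. mu i \<le> lam i \<and> lam (Suc i) \<le> mu i)"

text \<open>
  The skew polynomial in one variable, for \<open>lam \<in> partitions n\<close> and
  \<open>mu \<in> partitions (n - 1)\<close>. The truncated subtractions are exact whenever
  \<open>mu \<preceq> lam\<close>. The formula represents the polynomial only at \<open>x \<noteq> 0\<close>
  (because of \<open>c r / x\<close>); on the unit circle this is no restriction.
\<close>

definition sqW_skew ::
  "complex \<Rightarrow> nat \<Rightarrow> (nat \<Rightarrow> nat) \<Rightarrow> (nat \<Rightarrow> nat) \<Rightarrow> complex
    \<Rightarrow> (nat \<Rightarrow> complex) \<Rightarrow> (nat \<Rightarrow> complex) \<Rightarrow> complex" where
  "sqW_skew q n lam mu x c d =
     (if mu \<preceq> lam then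
        x ^ ((\<Sum>i<n. lam i) - (\<Sum>i<n. mu i)) *
        (\<Prod>r<n.
           (qpoch (c r / x) q (lam r - mu r) *
            qpoch (x * d r) q (mu r - lam (Suc r)) *
            qpoch q q (lam r - lam (Suc r))) /
           (qpoch q q (lam r - mu r) *
            qpoch q q (mu r - lam (Suc r)) *
            qpoch (c r * d r) q (lam r - lam (Suc r))))
      else 0)"

primrec sqW ::
  "complex \<Rightarrow> nat \<Rightarrow> (nat \<Rightarrow> nat) \<Rightarrow> (nat \<Rightarrow> complex)
    \<Rightarrow> (nat \<Rightarrow> complex) \<Rightarrow> (nat \<Rightarrow> complex) \<Rightarrow> complex" where
  "sqW q 0 lam x c d = 1"
| "sqW q (Suc n) lam x c d =
     (\<Sum>mu\<in>{mu \<in> partitions n. mu \<preceq> lam}.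
        sqW q n mu x (\<lambda>i. c (Suc i)) d * sqW_skew q (Suc n) lam mu (x n) c d)"

lemma finite_interlacing:
  assumes "lam \<in> partitions (Suc n)"
  shows "finite {mu \<in> partitions n. mu \<preceq> lam}"
proof (rule finite_subset)
  show "{mu \<in> partitions n. mu \<preceq> lam} \<subseteq>
      {f. \<forall>i. (i \<in> {..<n} \<longrightarrow> f i \<in> {..lam 0}) \<and> (i \<notin> {..<n} \<longrightarrow> f i = 0)}"
  proof clarify
    fix mu i assume mu: "mu \<in> partitions n" "mu \<preceq> lam"
    have "mu i \<le> lam i" using mu(2) by (simp add: interlaces_def)
    also have "lam i \<le> lam 0" using assms by (simp add: partitions_def antimono_def)
    finally have "mu i \<le> lam 0" .
    thus "(i \<in> {..<n} \<longrightarrow> mu i \<in> {..lam 0}) \<and> (i \<notin> {..<n} \<longrightarrow> mu i = 0)"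
      using mu(1) by (simp add: partitions_def)
  qed
  show "finite {f. \<forall>i. (i \<in> {..<n} \<longrightarrow> f i \<in> {..lam 0}) \<and> (i \<notin> {..<n} \<longrightarrow> f i = (0::nat))}"
    by (rule finite_set_of_finite_funs) auto
qed

text \<open>
  The value of the last \<open>d\<close>-parameter is immaterial by \<open>sqW_last_d_irrelevant\<close>
  below; it is set to 0.
\<close>

definition sqW_red ::
  "complex \<Rightarrow> nat \<Rightarrow> (nat \<Rightarrow> nat) \<Rightarrow> (nat \<Rightarrow> complex)
    \<Rightarrow> (nat \<Rightarrow> complex) \<Rightarrow> (nat \<Rightarrow> complex) \<Rightarrow> complex" where
  "sqW_red q n lam x c d = sqW q n lam x (c(n - 1 := 0)) (d(n - 1 := 0))"

lemma sqW_cong_d: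
  assumes "\<And>i. i < n \<Longrightarrow> d i = d' i"
  shows "sqW q n lam x c d = sqW q n lam x c d'"
  using assms
proof (induction n arbitrary: lam c)
  case (Suc n)
  have "sqW_skew q (Suc n) lam mu (x n) c d = sqW_skew q (Suc n) lam mu (x n) c d'" for mu
    unfolding sqW_skew_def using Suc.prems by (auto intro!: prod.cong)
  moreover have "sqW q n mu x (\<lambda>i. c (Suc i)) d = sqW q n mu x (\<lambda>i. c (Suc i)) d'" for mu
    using Suc.IH Suc.prems by simp
  ultimately show ?case by simp
qed simp

lemma sqW_last_d_irrelevant:
  assumes "n \<ge> 1" "c (n - 1) = 0" "\<And>i. i < n - 1 \<Longrightarrow> d i = d' i"
  shows "sqW q n lam x c d = sqW q n lam x c d'"
proof -
  obtain m where n: "n = Suc m" using assms(1) by (cases n) auto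
  have "sqW_skew q (Suc m) lam mu (x m) c d = sqW_skew q (Suc m) lam mu (x m) c d'"
    if "mu \<in> partitions m" for mu
  proof -
    have "mu m = 0" using that by (simp add: partitions_def)
    moreover have "c m = 0" using assms(2) n by simp
    ultimately show ?thesis
      unfolding sqW_skew_def using assms(3) n by (simp add: qpoch_def)
  qed
  moreover have "sqW q m mu x (\<lambda>i. c (Suc i)) d = sqW q m mu x (\<lambda>i. c (Suc i)) d'" for mu
    using assms(3) n by (intro sqW_cong_d) simp
  ultimately show ?thesis unfolding n by simp
qed

definition groth ::
  "nat \<Rightarrow> (nat \<Rightarrow> nat) \<Rightarrow> (nat \<Rightarrow> complex) \<Rightarrow> (nat \<Rightarrow> complex) \<Rightarrow> complex" where
  "groth n lam x b = sqW_red 0 n lam x (\<lambda>_. 0) b"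

definition groth_bar ::
  "nat \<Rightarrow> (nat \<Rightarrow> nat) \<Rightarrow> (nat \<Rightarrow> complex) \<Rightarrow> (nat \<Rightarrow> complex) \<Rightarrow> complex" where
  "groth_bar n lam x b = sqW_red 0 n lam x b (\<lambda>_. 0)"

text \<open>
  The integral of \<open>f(z\<^sub>0, \<dots>, z\<^sub>n\<^sub>-\<^sub>1) dz\<^sub>0 \<dots> dz\<^sub>n\<^sub>-\<^sub>1\<close> over the \<open>n\<close>-fold product of the
  positively oriented unit circle, as an iterated contour integral; coordinates with
  index at least \<open>n\<close> are filled with 0.
\<close>

primrec torus_integral :: "nat \<Rightarrow> ((nat \<Rightarrow> complex) \<Rightarrow> complex) \<Rightarrow> complex" where
  "torus_integral 0 f = f (\<lambda>_. 0)"
| "torus_integral (Suc n) f =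
     contour_integral (circlepath 0 1) (\<lambda>w. torus_integral n (\<lambda>z. f (z(n := w))))"

end

theory Submission
  imports Defs "Jordan_Normal_Form.Determinant"
begin

text \<open>
  At \<open>q = 0\<close> the branching rule collapses to a ratio of determinants. Write \<open>f\<^sub>\<lambda>\<close> for the
  polynomial with parameters \<open>c\<close>, \<open>d\<close> and last \<open>c\<close>-parameter 0. Then, with indices from 0,
  \<open>V(x) \<cdot> (\<Prod>j\<le>k<n-1. 1 - c\<^sub>k d\<^sub>j) \<cdot> f\<^sub>\<lambda>(x)\<close> is the determinant with entries
  \<open>x\<^sub>i ^ \<lambda>\<^sub>j (\<Prod>j\<le>k<n-1. x\<^sub>i - c\<^sub>k) (\<Prod>k<j. 1 - d\<^sub>k x\<^sub>i)\<close>,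
  where \<open>V\<close> is the Vandermonde product (lemma \<open>sqW_q0_bialternant\<close>). This is proved by induction
  on the number of variables. The partitions interlacing with \<open>\<lambda>\<close> form a product of intervals,
  and the branching coefficient is a product over these intervals, so that the sum over \<open>\<mu>\<close> can be
  carried out inside each column of the smaller determinant. Each such sum is, up to the factor
  \<open>x - y\<close> with the new variable \<open>y\<close>, a combination of two neighbouring columns of the larger
  determinant that vanishes at \<open>x = y\<close> (lemma \<open>bialt_col_branching\<close>); this is exactly the
  column elimination that clears the last row of the larger determinant up to its last entry.

  On the torus the two Vandermonde products, in \<open>z\<close> and in \<open>z\<^sup>-\<^sup>1\<close>, cancel
  \<open>\<Prod>i\<noteq>j. 1 - z\<^sub>i / z\<^sub>j\<close>. Expanding both determinants turns the integral into the sum over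
  pairs of permutations \<open>(p, s)\<close> of \<open>sign p \<cdot> sign s \<cdot> \<Prod>i<n. M (p i) (s i)\<close>, where
  \<open>M j k\<close> is the integral of one column against another. In \<open>M j k\<close> the factors
  \<open>1 - b\<^sub>l z\<close> cancel except those with \<open>l\<close> between \<open>j\<close> and \<open>k\<close>, and so
  \<open>M j k\<close> is zero, for \<open>j < k\<close>, unless \<open>\<lambda>\<^sub>j < \<mu>\<^sub>k\<close>, and, for \<open>j > k\<close>, unless
  \<open>\<mu>\<^sub>k \<le> \<lambda>\<^sub>j\<close>. Since \<open>\<lambda>\<close> and \<open>\<mu>\<close> are decreasing, these conditions are incompatible
  for all pairs with \<open>p \<noteq> s\<close> (lemma \<open>permutation_pair_unique\<close>). The \<open>n!\<close> diagonal pairs contribute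
  \<open>\<Prod>j<n. M j j\<close>, that is 1 or 0 according to whether \<open>\<lambda> = \<mu>\<close>.
\<close>

section \<open>Alternants\<close>

definition alternant :: "nat \<Rightarrow> (nat \<Rightarrow> 'a \<Rightarrow> 'b::idom) \<Rightarrow> (nat \<Rightarrow> 'a) \<Rightarrow> 'b" where
  "alternant n A x = Determinant.det (Matrix.mat n n (\<lambda>(i, j). A j (x i)))"

lemma alternant_expand_rows:
  "alternant n A x =
     (\<Sum>p | p permutes {..<n}. of_int (sign p) * (\<Prod>i<n. A (p i) (x i)))"
proof -
  have "(\<Prod>i<n. Matrix.mat n n (\<lambda>(i, j). A j (x i)) $$ (i, p i)) = (\<Prod>i<n. A (p i) (x i))"
    if "p permutes {..<n}" for p
    using permutes_in_image[OF that] by (intro prod.cong) auto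
  thus ?thesis
    unfolding alternant_def by (subst det_def'[of _ n]) (auto simp: atLeast0LessThan)
qed

lemma alternant_expand_cols:
  "alternant n A x =
     (\<Sum>p | p permutes {..<n}. of_int (sign p) * (\<Prod>j<n. A j (x (p j))))"
proof -
  have "(\<Prod>j<n. Matrix.mat n n (\<lambda>(i, j). A j (x i)) $$ (p j, j)) = (\<Prod>j<n. A j (x (p j)))"
    if "p permutes {..<n}" for p
    using permutes_in_image[OF that] by (intro prod.cong) auto
  thus ?thesis
    unfolding alternant_def by (subst det_col[of _ n]) (auto simp: atLeast0LessThan)
qed

lemma alternant_cong:
  assumes "\<And>i j. i < n \<Longrightarrow> j < n \<Longrightarrow> A j (x i) = B j (x i)"
  shows "alternant n A x = alternant n B x"
proof -
  have "(\<Prod>i<n. A (p i) (x i)) = (\<Prod>i<n. B (p i) (x i))" if "p permutes {..<n}" for p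
    using permutes_in_image[OF that] assms by (intro prod.cong) auto
  thus ?thesis
    unfolding alternant_expand_rows by simp
qed

lemma alternant_mult_rows:
  "alternant n (\<lambda>j z. f z * A j z) x = (\<Prod>i<n. f (x i)) * alternant n A x"
  by (simp add: alternant_expand_rows prod.distrib sum_distrib_left mult_ac)

lemma alternant_mult_cols:
  "alternant n (\<lambda>j z. f j * A j z) x = (\<Prod>j<n. f j) * alternant n A x"
  by (simp add: alternant_expand_cols prod.distrib sum_distrib_left mult_ac)

text \<open>
  Multilinearity, in the form in which a sum over interlacing partitions enters: one independent
  summation index per column.
\<close>

lemma alternant_sum_cols:
  assumes "\<And>j. j < n \<Longrightarrow> finite (B j)"
  shows "alternant n (\<lambda>j z. \<Sum>m\<in>B j. u j m z) x =
    (\<Sum>g\<in>PiE {..<n} B. alternant n (\<lambda>j. u j (g j)) x)"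
  unfolding alternant_expand_cols using assms
  by (subst prod_sum_PiE) (auto simp: sum_distrib_left intro: sum.swap)

text \<open>
  Multiplying on the right by the lower bidiagonal matrix with diagonal \<open>\<alpha>\<close> and subdiagonal
  \<open>- \<beta>\<close> replaces column \<open>j\<close> by \<open>\<alpha> j\<close> times itself minus \<open>\<beta> j\<close> times its right neighbour. If this
  clears the last row except for its last entry, the determinant drops to size \<open>n\<close>.
\<close>

lemma alternant_eliminate_last:
  assumes "\<And>j. j < n \<Longrightarrow> \<alpha> j * A j (x n) = \<beta> j * A (Suc j) (x n)"
  shows "alternant (Suc n) A x * (\<Prod>j<n. \<alpha> j) =
    A n (x n) * alternant n (\<lambda>j z. \<alpha> j * A j z - \<beta> j * A (Suc j) z) x"
proof -
  define M where "M = Matrix.mat (Suc n) (Suc n) (\<lambda>(i, j). A j (x i))"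
  define L where "L = Matrix.mat (Suc n) (Suc n) (\<lambda>(k, j).
    if k = j then (if j < n then \<alpha> j else 1) else if k = Suc j then - \<beta> j else 0)"
  define B where "B = Matrix.mat n n (\<lambda>(i, j). \<alpha> j * A j (x i) - \<beta> j * A (Suc j) (x i))"
  have carr: "M \<in> carrier_mat (Suc n) (Suc n)" "L \<in> carrier_mat (Suc n) (Suc n)"
    by (auto simp: M_def L_def)
  have "Determinant.det L = prod_list (diag_mat L)"
    by (rule det_lower_triangular[OF _ carr(2)]) (auto simp: L_def)
  also have "\<dots> = (\<Prod>j<n. \<alpha> j)"
    by (simp add: prod_list_diag_prod L_def atLeast0LessThan)
  finally have detL: "Determinant.det L = (\<Prod>j<n. \<alpha> j)" .
  have entry: "(M * L) $$ (i, j) =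
      (if j < n then \<alpha> j * A j (x i) - \<beta> j * A (Suc j) (x i) else A n (x i))"
    if ij: "i \<le> n" "j \<le> n" for i j
  proof -
    have "(M * L) $$ (i, j) = (\<Sum>k<Suc n. A k (x i) * L $$ (k, j))"
      using ij by (simp add: M_def L_def scalar_prod_def atLeast0LessThan)
    also have "\<dots> = (\<Sum>k\<in>{j, Suc j} \<inter> {..n}. A k (x i) * L $$ (k, j))"
      using ij by (intro sum.mono_neutral_right) (auto simp: L_def)
    also have "\<dots> = (if j < n then \<alpha> j * A j (x i) - \<beta> j * A (Suc j) (x i) else A n (x i))"
    proof (cases "j < n")
      case True
      hence "{j, Suc j} \<inter> {..n} = {j, Suc j}" by auto
      thus ?thesis using True by (simp add: L_def algebra_simps)
    next
      case False
      hence "{j, Suc j} \<inter> {..n} = {n}" "j = n" using ij by auto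
      thus ?thesis by (simp add: L_def)
    qed
    finally show ?thesis .
  qed
  have "M * L = four_block_mat B (Matrix.mat n 1 (\<lambda>(i, j). A n (x i))) (0\<^sub>m 1 n)
      (Matrix.mat 1 1 (\<lambda>_. A n (x n)))"
  proof (rule eq_matI, goal_cases)
    case (1 i j)
    hence ij: "i \<le> n" "j \<le> n" by (auto simp: B_def)
    show ?case
      using ij assms[of j] by (subst entry[OF ij]) (auto simp: B_def le_less)
  qed (use carr in \<open>auto simp: B_def\<close>)
  hence "Determinant.det (M * L) = Determinant.det B * Determinant.det (Matrix.mat 1 1 (\<lambda>_. A n (x n)))"
    by (subst det_four_block_mat_lower_left_zero[symmetric, where n = n and m = 1]) (auto simp: B_def)
  also have "Determinant.det (Matrix.mat 1 1 (\<lambda>_. A n (x n))) = A n (x n)"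
    by (simp add: det_single)
  finally show ?thesis
    using det_mult[OF carr] detL
    by (simp add: alternant_def M_def B_def mult_ac)
qed

section \<open>The branching sum in one variable\<close>

lemma qpoch_q0: "qpoch z 0 k = (if k = 0 then 1 else 1 - z)"
proof (cases k)
  case (Suc m)
  have "qpoch z 0 k = (1 - z) * (\<Prod>i<m. 1 - z * 0 ^ Suc i)"
    unfolding qpoch_def Suc by (subst prod.lessThan_Suc_shift) simp
  thus ?thesis using Suc by simp
qed (simp add: qpoch_def)

lemma qpoch_0_left [simp]: "qpoch 0 q k = 1"
  by (simp add: qpoch_def)

lemma qpoch_0_right [simp]: "qpoch z q 0 = 1"
  by (simp add: qpoch_def)

lemma geometric_interior:
  fixes x y :: "'a::comm_ring_1"
  assumes "p < q"
  shows "(x - y) * (\<Sum>m\<in>{p<..<q}. x ^ m * y ^ (q - m)) = x ^ q * y - x ^ Suc p * y ^ (q - p)"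
proof -
  from assms obtain t where q: "q = Suc (p + t)" using less_imp_Suc_add by blast
  show ?thesis unfolding q
  proof (induction t)
    case (Suc t)
    have "(\<Sum>m\<in>{p<..<Suc (p + Suc t)}. x ^ m * y ^ (Suc (p + Suc t) - m)) =
        x ^ (p + Suc t) * y + (\<Sum>m\<in>{p<..<Suc (p + t)}. x ^ m * y ^ (Suc (p + Suc t) - m))"
    proof -
      have "{p<..<Suc (p + Suc t)} = insert (p + Suc t) {p<..<Suc (p + t)}" by auto
      thus ?thesis by simp
    qed
    also have "(\<Sum>m\<in>{p<..<Suc (p + t)}. x ^ m * y ^ (Suc (p + Suc t) - m)) =
        y * (\<Sum>m\<in>{p<..<Suc (p + t)}. x ^ m * y ^ (Suc (p + t) - m))"
      unfolding sum_distrib_left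
    proof (rule sum.cong[OF refl], goal_cases)
      case (1 m)
      hence "Suc (p + Suc t) - m = Suc (Suc (p + t) - m)" by auto
      thus ?case by simp
    qed
    finally have "(x - y) * (\<Sum>m\<in>{p<..<Suc (p + Suc t)}. x ^ m * y ^ (Suc (p + Suc t) - m)) =
        (x - y) * (x ^ (p + Suc t) * y) +
        y * ((x - y) * (\<Sum>m\<in>{p<..<Suc (p + t)}. x ^ m * y ^ (Suc (p + t) - m)))"
      by (simp add: algebra_simps)
    thus ?case unfolding Suc.IH by (simp add: algebra_simps)
  next
    case 0
    have "{p<..<Suc (p + 0)} = {}" by auto
    thus ?case by (simp add: algebra_simps)
  qed
qed

text \<open>
  The factor contributed to the branching coefficient by one part \<open>m\<close> of the smaller partition, where
  \<open>p \<le> m \<le> q\<close> are the neighbouring parts of the larger one and \<open>y\<close> is the new variable.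
  The \<open>q\<close>-factorials of the general formula are 1 at \<open>q = 0\<close> and leave no trace; below, \<open>q\<close> is a part.
\<close>

definition weight :: "complex \<Rightarrow> complex \<Rightarrow> complex \<Rightarrow> nat \<Rightarrow> nat \<Rightarrow> nat \<Rightarrow> complex" where
  "weight c d y p q m = y ^ (q - m) *
     (qpoch (c / y) 0 (q - m) * qpoch (y * d) 0 (m - p) / qpoch (c * d) 0 (q - p))"

text \<open>
  The weight is constant up to powers of \<open>y\<close> strictly between the ends of the interval, so that only a
  geometric sum occurs. The shape of the result matters: the first term depends on \<open>q\<close> through
  \<open>x ^ q\<close>, the second on \<open>p\<close> through \<open>x ^ p\<close>, and the two agree at \<open>x = y\<close>.
\<close>

lemma weight_sum:
  assumes "p \<le> q" "y \<noteq> 0" "c * d \<noteq> 1"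
  shows "(1 - c * d) * (x - y) * (\<Sum>m\<in>{p..q}. weight c d y p q m * x ^ m) =
    (1 - y * d) * (x - c) * x ^ q - (y - c) * (1 - d * x) * x ^ p * y ^ (q - p)"
proof (cases "p = q")
  case True
  thus ?thesis by (simp add: weight_def qpoch_q0 algebra_simps)
next
  case False
  with assms have pq: "p < q" by simp
  have "{p..q} = insert p (insert q {p<..<q})" using pq by auto
  hence "(\<Sum>m\<in>{p..q}. weight c d y p q m * x ^ m) =
      weight c d y p q p * x ^ p + (weight c d y p q q * x ^ q +
        (\<Sum>m\<in>{p<..<q}. weight c d y p q m * x ^ m))"
    using pq by simp
  also have "(\<Sum>m\<in>{p<..<q}. weight c d y p q m * x ^ m) =
      (1 - c / y) * (1 - y * d) / (1 - c * d) * (\<Sum>m\<in>{p<..<q}. x ^ m * y ^ (q - m))"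
    unfolding sum_distrib_left by (rule sum.cong) (auto simp: weight_def qpoch_q0)
  finally have S: "(1 - c * d) * (\<Sum>m\<in>{p..q}. weight c d y p q m * x ^ m) =
      (1 - c / y) * y ^ (q - p) * x ^ p + (1 - y * d) * x ^ q +
      (1 - c / y) * (1 - y * d) * (\<Sum>m\<in>{p<..<q}. x ^ m * y ^ (q - m))"
    using pq assms by (simp add: weight_def qpoch_q0 distrib_left)
  have "(1 - c * d) * (x - y) * (\<Sum>m\<in>{p..q}. weight c d y p q m * x ^ m) =
      (x - y) * ((1 - c * d) * (\<Sum>m\<in>{p..q}. weight c d y p q m * x ^ m))"
    by (simp add: mult_ac)
  also have "\<dots> = (x - y) * ((1 - c / y) * y ^ (q - p) * x ^ p + (1 - y * d) * x ^ q) +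
      (1 - c / y) * (1 - y * d) * ((x - y) * (\<Sum>m\<in>{p<..<q}. x ^ m * y ^ (q - m)))"
    unfolding S by (simp only: distrib_left mult_ac)
  also have "\<dots> = (1 - y * d) * (x - c) * x ^ q - (y - c) * (1 - d * x) * x ^ p * y ^ (q - p)"
    unfolding geometric_interior[OF pq] using assms(2) by (simp add: field_simps)
  finally show ?thesis .
qed

section \<open>The bialternant formula at \<open>q = 0\<close>\<close>

definition vandermonde :: "nat \<Rightarrow> (nat \<Rightarrow> 'a) \<Rightarrow> 'a::comm_ring_1" where
  "vandermonde n x = (\<Prod>j<n. \<Prod>i<j. x i - x j)"

text \<open>
  The last \<open>c\<close>-parameter, which is 0, would contribute the factor \<open>x\<close> to every column. It is left out,
  so that the first product stops before \<open>n - 1\<close>.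
\<close>

definition bialt_col ::
  "nat \<Rightarrow> (nat \<Rightarrow> complex) \<Rightarrow> (nat \<Rightarrow> complex) \<Rightarrow> nat \<Rightarrow> nat \<Rightarrow> complex \<Rightarrow> complex" where
  "bialt_col n c d l j x = x ^ l * (\<Prod>k\<in>{j..<n - 1}. x - c k) * (\<Prod>k<j. 1 - d k * x)"

definition bialt_norm :: "nat \<Rightarrow> (nat \<Rightarrow> complex) \<Rightarrow> (nat \<Rightarrow> complex) \<Rightarrow> complex" where
  "bialt_norm n c d = (\<Prod>k<n - 1. \<Prod>j\<le>k. 1 - c k * d j)"

lemma sqW_skew_q0:
  assumes lam: "lam \<in> partitions (Suc n)" and mu: "mu \<in> partitions n" "mu \<preceq> lam"
    and "c n = 0"
  shows "sqW_skew 0 (Suc n) lam mu y c d =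
    y ^ lam n * (\<Prod>r<n. weight (c r) (d r) y (lam (Suc r)) (lam r) (mu r))"
proof -
  have mun: "mu n = 0" using mu(1) by (simp add: partitions_def)
  have lamn: "lam (Suc n) = 0" using lam by (simp add: partitions_def)
  have le: "mu i \<le> lam i" for i using mu(2) by (simp add: interlaces_def)
  have "(\<Sum>i<Suc n. lam i) - (\<Sum>i<Suc n. mu i) = lam n + (\<Sum>i<n. lam i - mu i)"
    using mun le sum_mono[of "{..<n}" mu lam] by (simp add: sum_subtractf_nat)
  moreover have "y ^ (\<Sum>i<n. lam i - mu i) = (\<Prod>i<n. y ^ (lam i - mu i))"
    by (simp add: power_sum)
  ultimately show ?thesis
    using mu(2) mun lamn assms(4)
    by (simp add: sqW_skew_def weight_def power_add prod.distrib prod_dividef)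
qed

text \<open>
  Any choice of \<open>mu i\<close> between \<open>lam (Suc i)\<close> and \<open>lam i\<close> is automatically decreasing, so the parts of
  an interlacing partition vary independently.
\<close>

lemma sum_interlacing:
  assumes lam: "lam \<in> partitions (Suc n)"
  shows "(\<Sum>mu\<in>{mu \<in> partitions n. mu \<preceq> lam}. F mu) =
    (\<Sum>g\<in>PiE {..<n} (\<lambda>i. {lam (Suc i)..lam i}). F (\<lambda>i. if i < n then g i else 0))"
proof (rule sum.reindex_bij_witness[where j = "\<lambda>mu. restrict mu {..<n}"
        and i = "\<lambda>g i. if i < n then g i else 0"], goal_cases)
  case (1 mu)
  thus ?case by (auto simp: partitions_def fun_eq_iff)
next
  case (2 mu)
  thus ?case by (auto simp: interlaces_def)
next
  case (3 g)
  thus ?case by (auto simp: fun_eq_iff PiE_def extensional_def)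
next
  case (4 g)
  let ?m = "\<lambda>i. if i < n then g i else 0"
  have lam0: "lam i = 0" if "i > n" for i
    using lam that by (simp add: partitions_def)
  have bd: "lam (Suc i) \<le> g i" "g i \<le> lam i" if "i < n" for i
    using 4 that by (auto simp: PiE_def Pi_def)
  have int: "?m \<preceq> lam"
    using bd lam0 by (auto simp: interlaces_def)
  have "?m (Suc i) \<le> ?m i" for i
    using int by (meson interlaces_def le_trans)
  hence "antimono ?m"
    by (intro antimonoI) (rule lift_Suc_antimono_le)
  with int show ?case
    by (simp add: partitions_def)
next
  case (5 mu)
  hence "(\<lambda>i. if i < n then restrict mu {..<n} i else 0) = mu"
    by (auto simp: partitions_def fun_eq_iff)
  thus ?case by simp
qed

text \<open>
  The column \<open>j\<close> in \<open>n\<close> variables, with the \<open>c\<close>-parameters shifted as in the recursion, differs from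
  the columns \<open>j\<close> and \<open>Suc j\<close> in \<open>n + 1\<close> variables only by the factors \<open>x - c j\<close> and \<open>1 - d j * x\<close>.
  These are the factors produced by the one-variable sum.
\<close>

lemma bialt_col_branching:
  assumes "j < n" "p \<le> q" "y \<noteq> 0" "c j * d j \<noteq> 1"
  shows "(1 - c j * d j) * ((x - y) *
      (\<Sum>m\<in>{p..q}. weight (c j) (d j) y p q m * bialt_col n (\<lambda>i. c (Suc i)) d m j x)) =
    (1 - y * d j) * bialt_col (Suc n) c d q j x -
    (y - c j) * y ^ (q - p) * bialt_col (Suc n) c d p (Suc j) x"
proof -
  define K where "K = (\<Prod>k\<in>{Suc j..<n}. x - c k) * (\<Prod>k<j. 1 - d k * x)"
  obtain n' where n': "n = Suc n'" using assms(1) by (cases n) auto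
  have 1: "bialt_col n (\<lambda>i. c (Suc i)) d m j x = x ^ m * K" for m
    unfolding bialt_col_def K_def n' prod.shift_bounds_Suc_ivl by simp
  have "{j..<n} = insert j {Suc j..<n}" using assms(1) by auto
  hence 2: "bialt_col (Suc n) c d q j x = x ^ q * (x - c j) * K"
    by (simp add: bialt_col_def K_def)
  have 3: "bialt_col (Suc n) c d p (Suc j) x = x ^ p * (1 - d j * x) * K"
    by (simp add: bialt_col_def K_def)
  have "(1 - c j * d j) * ((x - y) * (\<Sum>m\<in>{p..q}. weight (c j) (d j) y p q m * (x ^ m * K))) =
      ((1 - c j * d j) * (x - y) * (\<Sum>m\<in>{p..q}. weight (c j) (d j) y p q m * x ^ m)) * K"
    by (simp add: sum_distrib_left mult_ac)
  thus ?thesis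
    unfolding 1 2 3 weight_sum[OF assms(2-4)] by (simp add: algebra_simps)
qed

lemma bialt_norm_Suc:
  "bialt_norm (Suc n) c d = (\<Prod>j<n. 1 - c j * d j) * bialt_norm n (\<lambda>i. c (Suc i)) d"
proof -
  have "bialt_norm (Suc n) c d = (\<Prod>k<n. (1 - c k * d k) * (\<Prod>j<k. 1 - c k * d j))"
    by (simp add: bialt_norm_def lessThan_Suc_atMost[symmetric] mult_ac)
  also have "\<dots> = (\<Prod>j<n. 1 - c j * d j) * (\<Prod>k<n. \<Prod>j<k. 1 - c k * d j)"
    by (simp add: prod.distrib)
  also have "(\<Prod>k<n. \<Prod>j<k. 1 - c k * d j) = bialt_norm n (\<lambda>i. c (Suc i)) d"
  proof (cases n)
    case (Suc m)
    show ?thesis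
      unfolding bialt_norm_def Suc by (subst prod.lessThan_Suc_shift) (simp add: lessThan_Suc_atMost)
  qed (simp add: bialt_norm_def)
  finally show ?thesis .
qed

text \<open>
  The hypotheses on \<open>x\<close> and \<open>d\<close> make the factor \<open>\<Prod>j<n. 1 - x n * d j\<close> of the column elimination
  invertible; the one on \<open>c\<close> and \<open>d\<close> excludes zero denominators.
\<close>

lemma sqW_q0_bialternant:
  assumes "\<And>k. Suc k = n \<Longrightarrow> c k = 0"
    and "lam \<in> partitions n"
    and "\<And>i. i < n \<Longrightarrow> x i \<noteq> 0"
    and "\<And>i k. i < n \<Longrightarrow> Suc k < n \<Longrightarrow> x i * d k \<noteq> 1"
    and "\<And>j k. Suc j < n \<Longrightarrow> Suc k < n \<Longrightarrow> c k * d j \<noteq> 1"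
  shows "vandermonde n x * bialt_norm n c d * sqW 0 n lam x c d =
    alternant n (\<lambda>j. bialt_col n c d (lam j) j) x"
  using assms
proof (induction n arbitrary: c lam)
  case 0
  show ?case by (simp add: vandermonde_def bialt_norm_def alternant_expand_rows)
next
  case (Suc n)
  let ?c = "\<lambda>i. c (Suc i)"
  let ?y = "x n"
  define w where "w j = weight (c j) (d j) ?y (lam (Suc j)) (lam j)" for j
  define P where "P = (\<Prod>j<n. 1 - ?y * d j)"
  define Q where "Q = (\<Prod>j<n. 1 - c j * d j)"
  define V where "V = (\<Prod>i<n. x i - ?y)"
  have P0: "P \<noteq> 0" using Suc.prems(4)[of n] by (auto simp: P_def)
  have cn: "c n = 0" using Suc.prems(1) by simp
  have y0: "?y \<noteq> 0" using Suc.prems(3) by simp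
  have dec: "lam (Suc j) \<le> lam j" for j
    using Suc.prems(2) by (simp add: partitions_def antimono_def)
  have cd: "c j * d j \<noteq> 1" if "j < n" for j using Suc.prems(5)[of j j] that by simp
  note col = bialt_col_branching[where n = n and c = c and d = d and y = ?y, OF _ dec y0 cd]
  have IH: "vandermonde n x * bialt_norm n ?c d * sqW 0 n mu x ?c d =
      alternant n (\<lambda>j. bialt_col n ?c d (mu j) j) x" if "mu \<in> partitions n" for mu
    using that Suc.prems by (intro Suc.IH) auto
  have "alternant (Suc n) (\<lambda>j. bialt_col (Suc n) c d (lam j) j) x * P =
      bialt_col (Suc n) c d (lam n) n ?y * alternant n (\<lambda>j z.
        (1 - ?y * d j) * bialt_col (Suc n) c d (lam j) j z -
        (?y - c j) * ?y ^ (lam j - lam (Suc j)) * bialt_col (Suc n) c d (lam (Suc j)) (Suc j) z) x"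
    unfolding P_def
  proof (rule alternant_eliminate_last)
    fix j assume "j < n"
    \<comment> \<open>at \<open>x = y\<close> the left-hand side of the branching identity vanishes\<close>
    from col[OF this this, where x = ?y]
    show "(1 - ?y * d j) * bialt_col (Suc n) c d (lam j) j ?y =
        (?y - c j) * ?y ^ (lam j - lam (Suc j)) * bialt_col (Suc n) c d (lam (Suc j)) (Suc j) ?y"
      by simp
  qed
  also have "bialt_col (Suc n) c d (lam n) n ?y = ?y ^ lam n * P"
    by (simp add: bialt_col_def P_def mult.commute)
  also have "alternant n (\<lambda>j z.
        (1 - ?y * d j) * bialt_col (Suc n) c d (lam j) j z -
        (?y - c j) * ?y ^ (lam j - lam (Suc j)) * bialt_col (Suc n) c d (lam (Suc j)) (Suc j) z) x =
      alternant n (\<lambda>j z. (1 - c j * d j) * ((z - ?y) *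
        (\<Sum>m\<in>{lam (Suc j)..lam j}. w j m * bialt_col n ?c d m j z))) x"
    unfolding w_def by (rule alternant_cong) (rule col[symmetric])
  also have "\<dots> = Q * (V * alternant n (\<lambda>j z.
        \<Sum>m\<in>{lam (Suc j)..lam j}. w j m * bialt_col n ?c d m j z) x)"
    unfolding Q_def V_def
    by (subst alternant_mult_cols, subst alternant_mult_rows) (rule refl)
  also have "alternant n (\<lambda>j z. \<Sum>m\<in>{lam (Suc j)..lam j}. w j m * bialt_col n ?c d m j z) x =
      (\<Sum>g\<in>PiE {..<n} (\<lambda>j. {lam (Suc j)..lam j}).
        alternant n (\<lambda>j z. w j (g j) * bialt_col n ?c d (g j) j z) x)"
    by (rule alternant_sum_cols) simp
  also have "\<dots> = (\<Sum>mu\<in>{mu \<in> partitions n. mu \<preceq> lam}.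
        alternant n (\<lambda>j z. w j (mu j) * bialt_col n ?c d (mu j) j z) x)"
    unfolding sum_interlacing[OF Suc.prems(2)]
    by (intro sum.cong alternant_cong) auto
  also have "\<dots> = (\<Sum>mu\<in>{mu \<in> partitions n. mu \<preceq> lam}. (\<Prod>j<n. w j (mu j)) *
        (vandermonde n x * bialt_norm n ?c d * sqW 0 n mu x ?c d))"
  proof (rule sum.cong[OF refl])
    fix mu assume "mu \<in> {mu \<in> partitions n. mu \<preceq> lam}"
    thus "alternant n (\<lambda>j z. w j (mu j) * bialt_col n ?c d (mu j) j z) x = (\<Prod>j<n. w j (mu j)) *
        (vandermonde n x * bialt_norm n ?c d * sqW 0 n mu x ?c d)"
      by (subst alternant_mult_cols, subst IH) auto
  qed
  finally have "alternant (Suc n) (\<lambda>j. bialt_col (Suc n) c d (lam j) j) x * P =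
      (V * vandermonde n x * (Q * bialt_norm n ?c d) *
        (\<Sum>mu\<in>{mu \<in> partitions n. mu \<preceq> lam}.
          sqW 0 n mu x ?c d * (?y ^ lam n * (\<Prod>j<n. w j (mu j))))) * P"
    by (simp add: sum_distrib_left mult_ac)
  also have "(\<Sum>mu\<in>{mu \<in> partitions n. mu \<preceq> lam}.
          sqW 0 n mu x ?c d * (?y ^ lam n * (\<Prod>j<n. w j (mu j)))) =
      sqW 0 (Suc n) lam x c d"
    unfolding w_def sqW.simps
    by (intro sum.cong refl) (use Suc.prems(2) cn in \<open>auto simp: sqW_skew_q0\<close>)
  also have "V * vandermonde n x = vandermonde (Suc n) x"
    by (simp add: vandermonde_def V_def)
  also have "Q * bialt_norm n ?c d = bialt_norm (Suc n) c d"
    by (simp add: bialt_norm_Suc Q_def)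
  finally show ?case using P0 by simp
qed

section \<open>Specialisation to the Grothendieck polynomials\<close>

lemma one_minus_mult_nonzero:
  fixes z w :: complex
  assumes "norm z \<le> 1" "norm w < 1"
  shows "1 - z * w \<noteq> 0" "1 - w * z \<noteq> 0"
proof -
  have "norm (z * w) < 1"
    using assms mult_left_le_one_le[of "norm w" "norm z"] by (simp add: norm_mult mult.commute)
  thus "1 - z * w \<noteq> 0" "1 - w * z \<noteq> 0" by (auto simp: mult.commute)
qed

lemma bialt_col_cong:
  assumes "\<And>i. i < n - 1 \<Longrightarrow> c i = c' i" "\<And>i. i < n - 1 \<Longrightarrow> d i = d' i" "j < n"
  shows "bialt_col n c d l j = bialt_col n c' d' l j"
proof
  fix x
  have "(\<Prod>k\<in>{j..<n - 1}. x - c k) = (\<Prod>k\<in>{j..<n - 1}. x - c' k)"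
    using assms(1) by (intro prod.cong) auto
  moreover have "(\<Prod>k<j. 1 - d k * x) = (\<Prod>k<j. 1 - d' k * x)"
    using assms(2,3) by (intro prod.cong) auto
  ultimately show "bialt_col n c d l j x = bialt_col n c' d' l j x"
    by (simp add: bialt_col_def)
qed

text \<open>
  For \<open>G\<close> and its variant one of the two parameter families is zero, hence \<open>bialt_norm\<close> is 1.
\<close>

lemma groth_bialternant:
  assumes b: "\<And>i. i < n - 1 \<Longrightarrow> norm (b i) < 1" and "lam \<in> partitions n"
    and z: "\<And>i. i < n \<Longrightarrow> norm (z i) = 1"
  shows "vandermonde n z * groth n lam z b =
      alternant n (\<lambda>j. bialt_col n (\<lambda>_. 0) b (lam j) j) z"
proof -
  let ?b = "b(n - 1 := 0)"
  have "vandermonde n z * bialt_norm n ((\<lambda>_. 0)(n - 1 := 0)) ?b * groth n lam z b =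
      alternant n (\<lambda>j. bialt_col n ((\<lambda>_. 0)(n - 1 := 0)) ?b (lam j) j) z"
    unfolding groth_def sqW_red_def
  proof (rule sqW_q0_bialternant)
    fix i k assume "i < n" "Suc k < n"
    thus "z i * ?b k \<noteq> 1" using one_minus_mult_nonzero(1)[of "z i" "b k"] b[of k] z[of i] by auto
  next
    fix i assume "i < n"
    thus "z i \<noteq> 0" using z by fastforce
  qed (use assms in auto)
  also have "\<dots> = alternant n (\<lambda>j. bialt_col n (\<lambda>_. 0) b (lam j) j) z"
    by (intro alternant_cong fun_cong[OF bialt_col_cong]) auto
  finally show ?thesis by (simp add: bialt_norm_def)
qed

lemma groth_bar_bialternant:
  assumes "mu \<in> partitions n" and z: "\<And>i. i < n \<Longrightarrow> z i \<noteq> 0"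
  shows "vandermonde n z * groth_bar n mu z b =
      alternant n (\<lambda>j. bialt_col n b (\<lambda>_. 0) (mu j) j) z"
proof -
  let ?b = "b(n - 1 := 0)"
  have "vandermonde n z * bialt_norm n ?b ((\<lambda>_. 0)(n - 1 := 0)) * groth_bar n mu z b =
      alternant n (\<lambda>j. bialt_col n ?b ((\<lambda>_. 0)(n - 1 := 0)) (mu j) j) z"
    unfolding groth_bar_def sqW_red_def
    by (rule sqW_q0_bialternant) (use assms in auto)
  also have "\<dots> = alternant n (\<lambda>j. bialt_col n b (\<lambda>_. 0) (mu j) j) z"
    by (intro alternant_cong fun_cong[OF bialt_col_cong]) auto
  finally show ?thesis by (simp add: bialt_norm_def)
qed

lemma prod_off_diagonal:
  fixes f :: "nat \<Rightarrow> nat \<Rightarrow> 'a::comm_monoid_mult"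
  shows "(\<Prod>i<n. \<Prod>j\<in>{..<n} - {i}. f i j) = (\<Prod>j<n. \<Prod>i<j. f i j * f j i)"
proof (induction n)
  case (Suc n)
  have "(\<Prod>j\<in>{..<Suc n} - {i}. f i j) = f i n * (\<Prod>j\<in>{..<n} - {i}. f i j)" if "i < n" for i
  proof -
    have "{..<Suc n} - {i} = insert n ({..<n} - {i})" using that by auto
    thus ?thesis by simp
  qed
  moreover have "{..<Suc n} - {n} = {..<n}" by auto
  ultimately have "(\<Prod>i<Suc n. \<Prod>j\<in>{..<Suc n} - {i}. f i j) =
      (\<Prod>i<n. f i n * (\<Prod>j\<in>{..<n} - {i}. f i j)) * (\<Prod>j<n. f n j)"
    by simp
  thus ?case by (simp add: prod.distrib Suc.IH mult_ac)
qed simp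

lemma vandermonde_mult_inverse:
  fixes z :: "nat \<Rightarrow> 'a::field"
  assumes "\<And>i. i < n \<Longrightarrow> z i \<noteq> 0"
  shows "vandermonde n z * vandermonde n (\<lambda>i. inverse (z i)) =
    (\<Prod>i<n. \<Prod>j\<in>{..<n} - {i}. 1 - z i / z j)"
  unfolding prod_off_diagonal vandermonde_def prod.distrib[symmetric]
proof (intro prod.cong refl, goal_cases)
  case (1 j i)
  hence "z i \<noteq> 0" "z j \<noteq> 0" using assms by auto
  thus ?case by (simp add: field_simps)
qed

section \<open>Integrals of alternants over the torus\<close>

lemma torus_integral_cong:
  assumes "\<And>z. (\<And>i. i < n \<Longrightarrow> norm (z i) = 1) \<Longrightarrow> f z = g z"
  shows "torus_integral n f = torus_integral n g"
  using assms
proof (induction n arbitrary: f g)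
  case (Suc n)
  have "torus_integral n (\<lambda>z. f (z(n := w))) = torus_integral n (\<lambda>z. g (z(n := w)))"
    if "norm w = 1" for w
    using that by (intro Suc.IH Suc.prems) auto
  thus ?case
    by (auto intro!: contour_integral_eq simp: path_image_circlepath)
qed simp

lemma torus_integral_sum_prod:
  assumes "finite K"
    and "\<And>k i. k \<in> K \<Longrightarrow> i < n \<Longrightarrow> continuous_on (sphere 0 1) (h k i)"
  shows "torus_integral n (\<lambda>z. \<Sum>k\<in>K. a k * (\<Prod>i<n. h k i (z i))) =
    (\<Sum>k\<in>K. a k * (\<Prod>i<n. contour_integral (circlepath 0 1) (h k i)))"
  using assms
proof (induction n arbitrary: a)
  case (Suc n)
  define I where "I k = (\<Prod>i<n. contour_integral (circlepath 0 1) (h k i))" for k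
  have integ: "h k n contour_integrable_on circlepath 0 1" if "k \<in> K" for k
    using Suc.prems that
    by (intro contour_integrable_continuous_circlepath) (auto simp: path_image_circlepath)
  have "torus_integral n (\<lambda>z. \<Sum>k\<in>K. a k * (\<Prod>i<Suc n. h k i ((z(n := w)) i))) =
      (\<Sum>k\<in>K. a k * I k * h k n w)" for w
  proof -
    have "torus_integral n (\<lambda>z. \<Sum>k\<in>K. a k * (\<Prod>i<Suc n. h k i ((z(n := w)) i))) =
        torus_integral n (\<lambda>z. \<Sum>k\<in>K. (a k * h k n w) * (\<Prod>i<n. h k i (z i)))"
      by (simp add: mult_ac)
    also have "\<dots> = (\<Sum>k\<in>K. (a k * h k n w) * I k)"
      unfolding I_def using Suc.prems by (intro Suc.IH) auto
    finally show ?thesis by (simp add: mult_ac)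
  qed
  hence "torus_integral (Suc n) (\<lambda>z. \<Sum>k\<in>K. a k * (\<Prod>i<Suc n. h k i (z i))) =
      contour_integral (circlepath 0 1) (\<lambda>w. \<Sum>k\<in>K. a k * I k * h k n w)"
    by (simp only: torus_integral.simps)
  also have "\<dots> = (\<Sum>k\<in>K. contour_integral (circlepath 0 1) (\<lambda>w. a k * I k * h k n w))"
    using integ Suc.prems(1) by (intro contour_integral_sum contour_integrable_lmul) auto
  also have "\<dots> = (\<Sum>k\<in>K. a k * I k * contour_integral (circlepath 0 1) (h k n))"
    using integ by (intro sum.cong refl contour_integral_lmul) auto
  finally show ?case by (simp add: I_def mult_ac)
qed simp

text \<open>
  The Andreief identity before the double sum is collected into \<open>n!\<close> times one determinant. The
  expanded form is convenient here because most of its terms vanish individually.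
\<close>

lemma torus_integral_alternants:
  assumes "\<And>j k. j < n \<Longrightarrow> k < n \<Longrightarrow>
    continuous_on (sphere 0 1) (\<lambda>w. A j w * B k w * f w)"
  shows "torus_integral n (\<lambda>z. alternant n A z * alternant n B z * (\<Prod>i<n. f (z i))) =
    (\<Sum>p | p permutes {..<n}. \<Sum>s | s permutes {..<n}. of_int (sign p) * of_int (sign s) *
      (\<Prod>i<n. contour_integral (circlepath 0 1) (\<lambda>w. A (p i) w * B (s i) w * f w)))"
proof -
  define P where "P = {p. p permutes {..<n}}"
  have fin: "finite (P \<times> P)" by (simp add: P_def finite_permutations)
  have "alternant n A z * alternant n B z * (\<Prod>i<n. f (z i)) =
      (\<Sum>(p, s)\<in>P \<times> P. of_int (sign p) * of_int (sign s) *
        (\<Prod>i<n. A (p i) (z i) * B (s i) (z i) * f (z i)))" for z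
    unfolding alternant_expand_rows P_def[symmetric] sum_product sum.cartesian_product
    by (simp add: sum_distrib_left prod.distrib case_prod_unfold mult_ac)
  hence "torus_integral n (\<lambda>z. alternant n A z * alternant n B z * (\<Prod>i<n. f (z i))) =
      torus_integral n (\<lambda>z. \<Sum>k\<in>P \<times> P. (of_int (sign (fst k)) * of_int (sign (snd k))) *
        (\<Prod>i<n. A (fst k i) (z i) * B (snd k i) (z i) * f (z i)))"
    by (simp add: case_prod_unfold)
  also have "\<dots> = (\<Sum>k\<in>P \<times> P. (of_int (sign (fst k)) * of_int (sign (snd k))) *
        (\<Prod>i<n. contour_integral (circlepath 0 1) (\<lambda>w. A (fst k i) w * B (snd k i) w * f w)))"
  proof (rule torus_integral_sum_prod[OF fin])
    fix k i assume "k \<in> P \<times> P" "i < n"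
    hence "fst k i < n" "snd k i < n"
      using permutes_in_image[of _ "{..<n}" i] by (auto simp: P_def)
    thus "continuous_on (sphere 0 1) (\<lambda>w. A (fst k i) w * B (snd k i) w * f w)"
      by (rule assms)
  qed
  finally show ?thesis
    by (simp add: sum.cartesian_product case_prod_unfold P_def)
qed

section \<open>The one-variable integrals\<close>

lemma contour_integral_unit_circle_holomorphic:
  assumes "f holomorphic_on cball 0 1"
  shows "contour_integral (circlepath 0 1) f = 0"
  using Cauchy_theorem_convex_simple[OF assms convex_cball, of "circlepath 0 1"]
  by (auto simp: path_image_circlepath intro!: contour_integral_unique)

text \<open>
  If \<open>\<Phi>\<close> is a primitive of the entire function \<open>\<phi>\<close>, then \<open>- \<Phi> (1 / z)\<close> is a primitive of the
  integrand off the origin. In residue terms, all Laurent exponents are at most \<open>-2\<close>.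
\<close>

lemma contour_integral_unit_circle_inverse:
  assumes "\<phi> holomorphic_on UNIV"
  shows "contour_integral (circlepath 0 1) (\<lambda>z. \<phi> (inverse z) / z\<^sup>2) = 0"
proof -
  obtain \<Phi> where \<Phi>: "\<And>z. (\<Phi> has_field_derivative \<phi> z) (at z)"
    using holomorphic_convex_primitive'[OF convex_UNIV open_UNIV assms] by auto
  have "((\<lambda>z. - \<Phi> (inverse z)) has_field_derivative \<phi> (inverse z) / z\<^sup>2) (at z within - {0})"
    if "z \<in> - {0}" for z
  proof -
    have "((\<lambda>z. - \<Phi> (inverse z)) has_field_derivative
        - (\<phi> (inverse z) * - (inverse z ^ Suc (Suc 0)))) (at z within - {0})"
      using that
      by (intro DERIV_minus DERIV_chain2[OF \<Phi>] DERIV_inverse) auto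
    thus ?thesis by (simp add: field_simps power2_eq_square)
  qed
  from contour_integral_primitive[OF this, of "circlepath 0 1"] show ?thesis
    by (auto simp: path_image_circlepath intro!: contour_integral_unique)
qed

lemma inverse_minus_prod:
  fixes z :: "'a::field"
  assumes "z \<noteq> 0"
  shows "(\<Prod>l\<in>{k..<m}. inverse z - b l) = (\<Prod>l\<in>{k..<m}. 1 - b l * z) / z ^ (m - k)"
proof -
  have "(\<Prod>l\<in>{k..<m}. inverse z - b l) = (\<Prod>l\<in>{k..<m}. (1 - b l * z) / z)"
    using assms by (intro prod.cong) (auto simp: field_simps)
  thus ?thesis by (simp add: prod_dividef)
qed

text \<open>
  The one-variable integrand that pairs column \<open>j\<close> of the determinant for \<open>G\<close>, with part \<open>l\<close>, and
  column \<open>k\<close> of the one for its variant, with part \<open>m\<close>.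
\<close>

definition groth_kernel ::
  "nat \<Rightarrow> (nat \<Rightarrow> complex) \<Rightarrow> nat \<Rightarrow> nat \<Rightarrow> nat \<Rightarrow> nat \<Rightarrow> complex \<Rightarrow> complex" where
  "groth_kernel n b l m j k z =
     bialt_col n (\<lambda>_. 0) b l j z * bialt_col n b (\<lambda>_. 0) m k (inverse z) *
     (1 / (\<Prod>i<n - 1. 1 - z * b i) * (1 / (2 * of_real pi * \<i> * z)))"

context
  fixes n :: nat and b :: "nat \<Rightarrow> complex"
  assumes norm_b: "\<And>i. i < n - 1 \<Longrightarrow> norm (b i) < 1"
begin

text \<open>
  The \<open>b\<close>-factors of the two columns are those with index below \<open>j\<close> and those with index at least \<open>k\<close>.
  Divided by all of them, what remains is the overlap if \<open>k \<le> j\<close> and the inverse of the gap if \<open>j \<le> k\<close>;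
  as one of the two intervals below is empty, both cases are covered.
\<close>

lemma groth_kernel_eq:
  assumes z: "norm z = 1" and jk: "j < n" "k < n"
  shows "groth_kernel n b l m j k z = z ^ (l + (n - 1 - j)) / (z ^ (m + (n - 1 - k)) * z) *
     ((\<Prod>i\<in>{k..<j}. 1 - b i * z) / (\<Prod>i\<in>{j..<k}. 1 - b i * z)) / (2 * of_real pi * \<i>)"
proof -
  define Q where "Q S = (\<Prod>i\<in>S. 1 - b i * z)" for S
  have z0: "z \<noteq> 0" using z by auto
  have Q0: "Q {p..<q} \<noteq> 0" if "q \<le> n - 1" for p q
    using that norm_b z one_minus_mult_nonzero(2)[of z] by (auto simp: Q_def)
  have concat: "Q {p..<q} * Q {q..<r} = Q {p..<r}" if "p \<le> q" "q \<le> r" for p q r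
    unfolding Q_def by (rule prod.atLeastLessThan_concat[OF that])
  have ratio: "Q {0..<j} * Q {k..<n - 1} / Q {0..<n - 1} = Q {k..<j} / Q {j..<k}"
  proof (cases "j \<le> k")
    case True
    have "Q {0..<n - 1} = Q {0..<j} * Q {j..<k} * Q {k..<n - 1}"
      using True jk by (simp add: concat)
    thus ?thesis using True jk Q0[of j 0] Q0[of "n - 1" k] by (simp add: Q_def)
  next
    case False
    have "Q {0..<n - 1} = Q {0..<j} * Q {j..<n - 1}" "Q {k..<n - 1} = Q {k..<j} * Q {j..<n - 1}"
      using False jk by (simp_all add: concat)
    thus ?thesis using False jk Q0[of j 0] Q0[of "n - 1" j] by (simp add: Q_def)
  qed
  have "bialt_col n (\<lambda>_. 0) b l j z = z ^ (l + (n - 1 - j)) * Q {0..<j}"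
    by (simp add: bialt_col_def Q_def lessThan_atLeast0 power_add)
  moreover have "bialt_col n b (\<lambda>_. 0) m k (inverse z) = Q {k..<n - 1} / z ^ (m + (n - 1 - k))"
    unfolding bialt_col_def inverse_minus_prod[OF z0] Q_def
    by (simp add: power_add power_inverse divide_inverse)
  moreover have "(\<Prod>i<n - 1. 1 - z * b i) = Q {0..<n - 1}"
    by (simp add: Q_def lessThan_atLeast0 mult.commute)
  ultimately have "groth_kernel n b l m j k z = z ^ (l + (n - 1 - j)) / (z ^ (m + (n - 1 - k)) * z) *
      (Q {0..<j} * Q {k..<n - 1} / Q {0..<n - 1}) / (2 * of_real pi * \<i>)"
    unfolding groth_kernel_def by (simp add: mult_ac)
  thus ?thesis unfolding ratio unfolding Q_def .
qed

lemma continuous_on_groth_kernel: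
  assumes "j < n" "k < n"
  shows "continuous_on (sphere 0 1) (groth_kernel n b l m j k)"
proof (rule continuous_on_eq)
  show "continuous_on (sphere 0 1) (\<lambda>z. z ^ (l + (n - 1 - j)) / (z ^ (m + (n - 1 - k)) * z) *
     ((\<Prod>i\<in>{k..<j}. 1 - b i * z) / (\<Prod>i\<in>{j..<k}. 1 - b i * z)) / (2 * of_real pi * \<i>))"
    using assms norm_b one_minus_mult_nonzero(2)
    by (intro continuous_intros) (auto simp: dist_norm)
qed (use assms in \<open>auto simp: groth_kernel_eq\<close>)

text \<open>
  No pole is left at the origin, and the poles \<open>1 / b i\<close> lie outside the closed disc.
\<close>

lemma integral_groth_kernel_upper:
  assumes "j \<le> k" "k < n" "m \<le> l" "j < k \<or> m < l"
  shows "contour_integral (circlepath 0 1) (groth_kernel n b l m j k) = 0"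
proof -
  define e where "e = (l - m) + (k - j) - 1"
  have e: "l + (n - 1 - j) = (m + (n - 1 - k) + 1) + e"
    using assms by (auto simp: e_def)
  have "contour_integral (circlepath 0 1) (groth_kernel n b l m j k) =
      contour_integral (circlepath 0 1)
        (\<lambda>z. z ^ e / (\<Prod>i\<in>{j..<k}. 1 - b i * z) / (2 * of_real pi * \<i>))"
  proof (rule contour_integral_eq)
    fix z :: complex assume "z \<in> path_image (circlepath 0 1)"
    hence z: "norm z = 1" by (simp add: path_image_circlepath)
    hence "z \<noteq> 0" by auto
    hence "z ^ (l + (n - 1 - j)) / (z ^ (m + (n - 1 - k)) * z) = z ^ e"
      unfolding e by (simp add: power_add)
    thus "groth_kernel n b l m j k z =
        z ^ e / (\<Prod>i\<in>{j..<k}. 1 - b i * z) / (2 * of_real pi * \<i>)"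
      using groth_kernel_eq[OF z, of j k l m] assms by simp
  qed
  also have "\<dots> = 0"
    using assms norm_b one_minus_mult_nonzero(2)
    by (intro contour_integral_unit_circle_holomorphic holomorphic_intros) auto
  finally show ?thesis .
qed

text \<open>
  Here the integrand is a Laurent polynomial. The \<open>j - k\<close> factors \<open>1 - b i * z\<close> are compensated by the
  power \<open>z ^ (j - k)\<close> in the denominator, so that the largest exponent is \<open>l - m - 1 \<le> -2\<close>.
\<close>

lemma integral_groth_kernel_lower:
  assumes "k \<le> j" "j < n" "l < m"
  shows "contour_integral (circlepath 0 1) (groth_kernel n b l m j k) = 0"
proof -
  define e where "e = m - l - 1"
  define \<phi> where "\<phi> w = w ^ e * (\<Prod>i\<in>{k..<j}. w - b i) / (2 * of_real pi * \<i>)" for w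
  have e: "m + (n - 1 - k) + 1 = (l + (n - 1 - j)) + (e + (j - k) + 2)"
    using assms by (auto simp: e_def)
  have "contour_integral (circlepath 0 1) (groth_kernel n b l m j k) =
      contour_integral (circlepath 0 1) (\<lambda>z. \<phi> (inverse z) / z\<^sup>2)"
  proof (rule contour_integral_eq)
    fix z :: complex assume "z \<in> path_image (circlepath 0 1)"
    hence z: "norm z = 1" by (simp add: path_image_circlepath)
    hence z0: "z \<noteq> 0" by auto
    have "z ^ (m + (n - 1 - k)) * z = z ^ (l + (n - 1 - j)) * (z ^ e * z ^ (j - k) * z\<^sup>2)"
      using arg_cong[OF e, of "\<lambda>i. z ^ i"] by (simp only: power_add power_one_right)
    hence "z ^ (l + (n - 1 - j)) / (z ^ (m + (n - 1 - k)) * z) = 1 / (z ^ e * z ^ (j - k) * z\<^sup>2)"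
      using z0 by simp
    hence "groth_kernel n b l m j k z =
        1 / (z ^ e * z ^ (j - k) * z\<^sup>2) * (\<Prod>i\<in>{k..<j}. 1 - b i * z) / (2 * of_real pi * \<i>)"
      using groth_kernel_eq[OF z, of j k l m] assms by simp
    also have "\<dots> = \<phi> (inverse z) / z\<^sup>2"
      unfolding \<phi>_def inverse_minus_prod[OF z0]
      by (simp only: divide_inverse inverse_mult_distrib power_inverse mult_1 mult_ac)
    finally show "groth_kernel n b l m j k z = \<phi> (inverse z) / z\<^sup>2" .
  qed
  also have "\<dots> = 0"
    by (rule contour_integral_unit_circle_inverse)
      (auto simp: \<phi>_def intro!: holomorphic_intros)
  finally show ?thesis .
qed

lemma integral_groth_kernel_diagonal:
  assumes "j < n"
  shows "contour_integral (circlepath 0 1) (groth_kernel n b l m j j) = (if l = m then 1 else 0)"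
proof (cases "l = m")
  case True
  have "contour_integral (circlepath 0 1) (groth_kernel n b l m j j) =
      contour_integral (circlepath 0 1) (\<lambda>z. 1 / (2 * of_real pi * \<i>) * (1 / (z - 0)))"
  proof (rule contour_integral_eq)
    fix z :: complex assume "z \<in> path_image (circlepath 0 1)"
    hence z: "norm z = 1" by (simp add: path_image_circlepath)
    hence "z \<noteq> 0" by auto
    thus "groth_kernel n b l m j j z = 1 / (2 * of_real pi * \<i>) * (1 / (z - 0))"
      using groth_kernel_eq[OF z assms assms] True by simp
  qed
  also have "\<dots> = 1 / (2 * of_real pi * \<i>) * contour_integral (circlepath 0 1) (\<lambda>z. 1 / (z - 0))"
    by (intro contour_integral_lmul contour_integrable_continuous_circlepath continuous_intros)
      (auto simp: path_image_circlepath)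
  also have "\<dots> = 1"
    by (subst contour_integral_circlepath) auto
  finally show ?thesis using True by simp
next
  case False
  thus ?thesis
    using assms integral_groth_kernel_upper[of j j m l] integral_groth_kernel_lower[of j j l m]
    by (cases "m < l") auto
qed

end

section \<open>Orthonormality\<close>

text \<open>
  At the smallest \<open>k\<close> with different preimages under \<open>p\<close> and \<open>s\<close>, both permutations pair \<open>k\<close> with a
  larger index: \<open>lam k < mu k'\<close> for some \<open>k' > k\<close> and \<open>mu k \<le> lam j\<close> for some \<open>j > k\<close>. Monotonicity
  then gives \<open>lam k < mu k \<le> lam k\<close>.
\<close>

lemma permutation_pair_unique:
  fixes lam mu :: "nat \<Rightarrow> nat"
  assumes anti: "antimono lam" "antimono mu"
    and p: "p permutes {..<n}" and s: "s permutes {..<n}"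
    and above: "\<And>i. i < n \<Longrightarrow> p i < s i \<Longrightarrow> lam (p i) < mu (s i)"
    and below: "\<And>i. i < n \<Longrightarrow> s i < p i \<Longrightarrow> mu (s i) \<le> lam (p i)"
  shows "p = s"
proof -
  have eq: "inv_into UNIV p k = inv_into UNIV s k" if "k < n" for k
    using that
  proof (induction k rule: less_induct)
    case (less k)
    show ?case
    proof (rule ccontr)
      assume ne: "inv_into UNIV p k \<noteq> inv_into UNIV s k"
      define a b where "a = inv_into UNIV p k" and "b = inv_into UNIV s k"
      have ps: "p a = k" "s b = k"
        unfolding a_def b_def using p s by (simp_all add: permutes_inverses)
      have ab: "a < n" "b < n"
        unfolding a_def b_def
        using permutes_in_image[OF permutes_inv[OF p]] permutes_in_image[OF permutes_inv[OF s]] less.prems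
        by auto
      have bounds: "s a < n" "p b < n"
        using ab permutes_in_image[OF p] permutes_in_image[OF s] by auto
      have inv_img: "inv_into UNIV s (s a) = a" "inv_into UNIV p (p b) = b"
        using p s by (simp_all add: permutes_inverses)
      have "\<not> s a < k" using less.IH[of "s a"] bounds inv_img ps ne a_def b_def
        by (metis p permutes_inverses(1) nat_neq_iff)
      moreover have "s a \<noteq> k" using inv_img ne a_def b_def by metis
      ultimately have sa: "k < s a" by simp
      have "\<not> p b < k" using less.IH[of "p b"] bounds inv_img ps ne a_def b_def
        by (metis s permutes_inverses(1) nat_neq_iff)
      moreover have "p b \<noteq> k" using inv_img ne a_def b_def by metis
      ultimately have pb: "k < p b" by simp
      have "lam k < mu (s a)" using above[OF ab(1)] ps sa by simp
      also have "\<dots> \<le> mu k" using anti(2) sa by (auto simp: antimono_def)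
      also have "\<dots> \<le> lam (p b)" using below[OF ab(2)] ps pb by simp
      also have "\<dots> \<le> lam k" using anti(1) pb by (auto simp: antimono_def)
      finally show False by simp
    qed
  qed
  have "inv_into UNIV p k = inv_into UNIV s k" for k
    using eq[of k] permutes_not_in[OF permutes_inv[OF p], of k]
      permutes_not_in[OF permutes_inv[OF s], of k] by (cases "k < n") auto
  hence "inv_into UNIV p = inv_into UNIV s" by blast
  thus ?thesis by (metis p s permutes_inv_inv)
qed

theorem theorem5p1:
  fixes n :: nat and b :: "nat \<Rightarrow> complex" and lam mu :: "nat \<Rightarrow> nat"
  assumes "n \<ge> 1"
    and "\<And>j. j < n - 1 \<Longrightarrow> norm (b j) < 1"
    and "lam \<in> partitions n" and "mu \<in> partitions n"
  shows "1 / fact n *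
      torus_integral n (\<lambda>z.
        groth n lam z b * groth_bar n mu (\<lambda>i. inverse (z i)) b *
        ((\<Prod>i<n. \<Prod>j\<in>{..<n} - {i}. 1 - z i / z j) /
         (\<Prod>i<n. \<Prod>j<n - 1. 1 - z i * b j)) *
        (\<Prod>i<n. 1 / (2 * of_real pi * \<i> * z i))) =
    (if lam = mu then 1 else 0)"
proof -
  define u where "u j = bialt_col n (\<lambda>_. 0) b (lam j) j" for j
  define v where "v k z = bialt_col n b (\<lambda>_. 0) (mu k) k (inverse z)" for k z
  define f where "f z = 1 / (\<Prod>j<n - 1. 1 - z * b j) * (1 / (2 * of_real pi * \<i> * z))" for z
  define M where "M j k = contour_integral (circlepath 0 1) (groth_kernel n b (lam j) (mu k) j k)" for j k
  have kernel: "(\<lambda>z. u j z * v k z * f z) = groth_kernel n b (lam j) (mu k) j k" for j k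
    by (rule ext) (simp only: groth_kernel_def u_def v_def f_def)
  have "torus_integral n (\<lambda>z.
        groth n lam z b * groth_bar n mu (\<lambda>i. inverse (z i)) b *
        ((\<Prod>i<n. \<Prod>j\<in>{..<n} - {i}. 1 - z i / z j) /
         (\<Prod>i<n. \<Prod>j<n - 1. 1 - z i * b j)) *
        (\<Prod>i<n. 1 / (2 * of_real pi * \<i> * z i))) =
      torus_integral n (\<lambda>z. alternant n u z * alternant n v z * (\<Prod>i<n. f (z i)))"
  proof (rule torus_integral_cong)
    fix z :: "nat \<Rightarrow> complex" assume z: "\<And>i. i < n \<Longrightarrow> norm (z i) = 1"
    have z0: "z i \<noteq> 0" if "i < n" for i using z[OF that] by auto
    have U: "alternant n u z = vandermonde n z * groth n lam z b"
      unfolding u_def using assms z by (intro groth_bialternant[symmetric])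
    have "vandermonde n (\<lambda>i. inverse (z i)) * groth_bar n mu (\<lambda>i. inverse (z i)) b =
        alternant n (\<lambda>k. bialt_col n b (\<lambda>_. 0) (mu k) k) (\<lambda>i. inverse (z i))"
      using assms z0 by (intro groth_bar_bialternant) auto
    also have "\<dots> = alternant n v z"
      by (simp add: alternant_def v_def)
    finally have V: "alternant n v z =
        vandermonde n (\<lambda>i. inverse (z i)) * groth_bar n mu (\<lambda>i. inverse (z i)) b" ..
    have VV: "(\<Prod>i<n. \<Prod>j\<in>{..<n} - {i}. 1 - z i / z j) =
        vandermonde n z * vandermonde n (\<lambda>i. inverse (z i))"
      by (rule vandermonde_mult_inverse[symmetric]) (rule z0)
    have F: "(\<Prod>i<n. f (z i)) =
        1 / (\<Prod>i<n. \<Prod>j<n - 1. 1 - z i * b j) * (\<Prod>i<n. 1 / (2 * of_real pi * \<i> * z i))"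
      by (simp add: f_def prod.distrib prod_dividef)
    show "groth n lam z b * groth_bar n mu (\<lambda>i. inverse (z i)) b *
        ((\<Prod>i<n. \<Prod>j\<in>{..<n} - {i}. 1 - z i / z j) /
         (\<Prod>i<n. \<Prod>j<n - 1. 1 - z i * b j)) *
        (\<Prod>i<n. 1 / (2 * of_real pi * \<i> * z i)) =
      alternant n u z * alternant n v z * (\<Prod>i<n. f (z i))"
      unfolding U V VV F by (simp add: mult_ac)
  qed
  also have "\<dots> = (\<Sum>p | p permutes {..<n}. \<Sum>s | s permutes {..<n}.
      of_int (sign p) * of_int (sign s) * (\<Prod>i<n. M (p i) (s i)))"
    unfolding M_def kernel[symmetric]
  proof (rule torus_integral_alternants[of n u v f])
    fix j k assume "j < n" "k < n"
    thus "continuous_on (sphere 0 1) (\<lambda>w. u j w * v k w * f w)"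
      unfolding kernel using assms(2) by (intro continuous_on_groth_kernel)
  qed
  (* off-diagonal pairs vanish term by term, so no cancellation of signs is involved *)
  also have "\<dots> = (\<Sum>p | p permutes {..<n}. \<Sum>s | s permutes {..<n}.
      if s = p then \<Prod>j<n. M j j else 0)"
  proof (intro sum.cong refl)
    fix p s :: "nat \<Rightarrow> nat"
    assume "p \<in> {p. p permutes {..<n}}" "s \<in> {s. s permutes {..<n}}"
    hence p: "p permutes {..<n}" and s: "s permutes {..<n}" by auto
    have lt: "p i < n" "s i < n" if "i < n" for i
      using that permutes_in_image[OF p, of i] permutes_in_image[OF s, of i] by auto
    show "of_int (sign p) * of_int (sign s) * (\<Prod>i<n. M (p i) (s i)) =
        (if s = p then \<Prod>j<n. M j j else 0)"
    proof (cases "s = p")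
      case True
      have "(\<Prod>i<n. M (p i) (p i)) = (\<Prod>j<n. M j j)"
        using prod.permute[OF p, of "\<lambda>j. M j j"] by (simp add: o_def)
      moreover have "of_int (sign p) * of_int (sign p) = (1::complex)"
        by (simp add: sign_def)
      ultimately show ?thesis using True by simp
    next
      case False
      have "\<exists>i<n. M (p i) (s i) = 0"
      proof (rule ccontr)
        assume "\<not> ?thesis"
        hence nz: "M (p i) (s i) \<noteq> 0" if "i < n" for i using that by blast
        have "p = s"
        proof (rule permutation_pair_unique[OF _ _ p s])
          show "antimono lam" "antimono mu" using assms by (auto simp: partitions_def)
          fix i assume i: "i < n"
          show "lam (p i) < mu (s i)" if "p i < s i"
            using nz[OF i] lt[OF i] that assms(2) integral_groth_kernel_upper[of n b "p i" "s i" "mu (s i)" "lam (p i)"]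
            by (force simp: M_def)
          show "mu (s i) \<le> lam (p i)" if "s i < p i"
            using nz[OF i] lt[OF i] that assms(2) integral_groth_kernel_lower[of n b "s i" "p i" "lam (p i)" "mu (s i)"]
            by (force simp: M_def)
        qed
        with False show False by simp
      qed
      thus ?thesis using False by auto
    qed
  qed
  also have "\<dots> = fact n * (\<Prod>j<n. M j j)"
    by (simp add: sum.delta finite_permutations card_permutations)
  also have "(\<Prod>j<n. M j j) = (\<Prod>j<n. if lam j = mu j then 1 else 0)"
    unfolding M_def using assms(2) by (intro prod.cong refl integral_groth_kernel_diagonal) auto
  also have "\<dots> = (if lam = mu then 1 else 0)"
  proof (cases "lam = mu")
    case False
    then obtain j where "lam j \<noteq> mu j" by auto
    moreover from this have "j < n"
      using assms(3,4) by (metis (mono_tags, lifting) mem_Collect_eq not_le partitions_def)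
    ultimately show ?thesis using False by auto
  qed simp
  finally show ?thesis by simp
qed

end
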